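(* Let $N\ge1$ be an integer, $c>0$ and $b>0$ a real number. The convergence $X_b^{\varepsilon+}\longrightarrow X_b^+$ as $\varepsilon\to0^+$ holds, i.e. for any $\mu\in\mathbb{R}$, $$\lim_{\varepsilon\to0^+}\mathbb{E}\Big(\mathrm{e}^{\mathrm{i}\mu X_b^{\varepsilon+}}1_{\{\tau_b^{\varepsilon+}<+\infty\}}\Big)=\mathbb{E}\Big(\mathrm{e}^{\mathrm{i}\mu X_b^+}1_{\{\tau_b^+<+\infty\}}\Big),$$ where, for any $\mu\in\mathbb{R}$, $$\mathbb{E}\Big(\mathrm{e}^{\mathrm{i}\mu X_b^+}1_{\{\tau_b^+<+\infty\}}\Big)=\mathrm{e}^{\mathrm{i}\mu b}\sum_{j=0}^{N-1}\frac{(-\mathrm{i}\mu b)^j}{j!}.$$ This is the Fourier transform of the pseudo-random variable $X_b^+$. Moreover, $\mathbb{P}\{\tau_b^+<+\infty\}=1$.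
   Context: Pseudo-random walk: put $p_k=\delta_{k0}+(-1)^{k-1}c\binom{2N}{k+N}$ for $k\in\{-N,\dots,N\}$ (real, possibly negative, summing to $1$), $p_k=0$ otherwise. The $U_n$ are i.i.d. pseudo-random variables, $\mathbb{P}\{U_1=k_1,\dots,U_n=k_n\}=p_{k_1}\cdots p_{k_n}$; $S_0=0$, $S_n=U_1+\dots+U_n$. For an integer $\beta\ge1$, $\sigma_\beta^+=\min\{n\ge1:S_n\ge\beta\}$, $S_\beta^+=S_{\sigma_\beta^+}\in\{\beta,\dots,\beta+N-1\}$, $\mathbb{P}\{\sigma_\beta^+=k,S_\beta^+=\ell\}=\mathbb{P}\{S_1<\beta,\dots,S_{k-1}<\beta,S_k=\ell\}$; $H_{\beta,\ell}^+(z)=\sum_{k\ge1}\mathbb{P}\{\sigma_\beta^+=k,S_\beta^+=\ell\}z^k$ converges absolutely for $|z|<1/\sum_k|p_k|$ and is extended to $(0,1)$ by (unique) real-analytic continuation; $\mathbb{P}\{S_\beta^+=\ell,\sigma_\beta^+<+\infty\}:=\lim_{z\to1^-}H_{\beta,\ell}^+(z)$. Normalized walk: $X_t^\varepsilon=\varepsilon S_{\lfloor t/\varepsilon^{2N}\rfloor}$; $\tau_b^{\varepsilon+}=\inf\{t\ge0:X_t^\varepsilon\ge b\}$, $X_b^{\varepsilon+}=X^\varepsilon_{\tau_b^{\varepsilon+}}$. With $b_\varepsilon=\lceil b/\varepsilon\rceil$, $X_b^{\varepsilon+}=\varepsilon S_{b_\varepsilon}^+$, so that $$\mathbb{E}\Big(\mathrm{e}^{\mathrm{i}\mu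 X_b^{\varepsilon+}}1_{\{\tau_b^{\varepsilon+}<+\infty\}}\Big)=\sum_{\ell=b_\varepsilon}^{b_\varepsilon+N-1}\mathrm{e}^{\mathrm{i}\mu\varepsilon\ell}\,\mathbb{P}\{S_{b_\varepsilon}^+=\ell,\sigma_{b_\varepsilon}^+<+\infty\}.$$ Limit: $(X_t)_{t\ge0}$ is the pseudo-Brownian motion (pseudo-process with independent stationary increments and $\mathbb{E}(\mathrm{e}^{\mathrm{i}uX_t})=\mathrm{e}^{-ctu^{2N}}$), $\tau_b^+=\inf\{t\ge0:X_t\ge b\}$, $X_b^+=X_{\tau_b^+}$; the pseudo-distribution of $X_b^+$ is understood through its Fourier transform, the limit as $\varepsilon\to0^+$ of that of $X_b^{\varepsilon+}$, and $\mathbb{P}\{\tau_b^+<+\infty\}$ is its value at $\mu=0$. The content is the existence and explicit value of the limit. *)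

theory Defs
  imports "HOL-Analysis.Analysis" "HOL-Library.FuncSet"
begin

text \<open>The one-step weights: real numbers of arbitrary sign summing to 1 (\<open>p\<^sub>k\<close>).\<close>

definition step_weight :: "nat \<Rightarrow> real \<Rightarrow> int \<Rightarrow> real" where
  "step_weight N c k =
     (if - int N \<le> k \<and> k \<le> int N
      then (if k = 0 then 1 else 0)
           + ((-1) powi (k - 1)) * c * real ((2 * N) choose nat (k + int N))
      else 0)"

text \<open>A path is given by its increments \<open>u 1, u 2, \<dots>\<close>; \<open>u 0\<close> is never used.\<close>

definition walk :: "(nat \<Rightarrow> int) \<Rightarrow> nat \<Rightarrow> int" where
  "walk u n = (\<Sum>i = 1..n. u i)"

text \<open>Pseudo-probability of an event \<open>A\<close> depending only on the first \<open>n\<close> increments.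
  There is no countably additive signed measure on infinite paths behind it.\<close>

definition pseudo_prob :: "nat \<Rightarrow> real \<Rightarrow> nat \<Rightarrow> ((nat \<Rightarrow> int) \<Rightarrow> bool) \<Rightarrow> real" where
  "pseudo_prob N c n A =
     (\<Sum>u \<in> {u \<in> {1..n} \<rightarrow>\<^sub>E {- int N..int N}. A u}. \<Prod>i = 1..n. step_weight N c (u i))"

text \<open>\<open>\<P>{\<sigma>\<^sub>\<beta>\<^sup>+ = k, S\<^sub>\<beta>\<^sup>+ = l}\<close>, for \<open>k \<ge> 1\<close>.\<close>

definition first_passage_prob :: "nat \<Rightarrow> real \<Rightarrow> int \<Rightarrow> int \<Rightarrow> nat \<Rightarrow> real" where
  "first_passage_prob N c \<beta> l k =
     pseudo_prob N c k (\<lambda>u. (\<forall>j \<in> {1..<k}. walk u j < \<beta>) \<and> walk u k = l)"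

definition real_analytic_on :: "(real \<Rightarrow> real) \<Rightarrow> real set \<Rightarrow> bool" where
  "real_analytic_on f A \<longleftrightarrow>
     (\<forall>x \<in> A. \<exists>r > 0. \<exists>a. \<forall>y. \<bar>y - x\<bar> < r \<longrightarrow> (\<lambda>n. a n * (y - x) ^ n) sums f y)"

text \<open>\<open>f\<close> continues the power series \<open>\<Sum>k\<ge>1. \<P>{\<sigma>\<^sub>\<beta>\<^sup>+ = k, S\<^sub>\<beta>\<^sup>+ = l} z\<^sup>k\<close> from the interval
  \<open>(0, 1 / \<Sum>k. \<bar>p\<^sub>k\<bar>)\<close>, which is contained in \<open>(0, 1)\<close>, to \<open>(0, 1)\<close>.\<close>

definition is_continuation :: "nat \<Rightarrow> real \<Rightarrow> int \<Rightarrow> int \<Rightarrow> (real \<Rightarrow> real) \<Rightarrow> bool" where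
  "is_continuation N c \<beta> l f \<longleftrightarrow>
     real_analytic_on f {0<..<1} \<and>
     (\<forall>z. 0 < z \<and> z < 1 / (\<Sum>k = - int N..int N. \<bar>step_weight N c k\<bar>) \<longrightarrow>
        (\<lambda>k. first_passage_prob N c \<beta> l (Suc k) * z ^ Suc k) sums f z)"

text \<open>Values outside \<open>(0, 1)\<close> are irrelevant; on \<open>(0, 1)\<close> the continuation is unique.\<close>

definition passage_gf :: "nat \<Rightarrow> real \<Rightarrow> int \<Rightarrow> int \<Rightarrow> real \<Rightarrow> real" where
  "passage_gf N c \<beta> l = (SOME f. is_continuation N c \<beta> l f)"

text \<open>\<open>\<P>{S\<^sub>\<beta>\<^sup>+ = l, \<sigma>\<^sub>\<beta>\<^sup>+ < \<infinity>}\<close>\<close>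

definition passage_place_prob :: "nat \<Rightarrow> real \<Rightarrow> int \<Rightarrow> int \<Rightarrow> real" where
  "passage_place_prob N c \<beta> l = Lim (at_left 1) (passage_gf N c \<beta> l)"

text \<open>The normalized walk along a path, and its first passage time. The definition of the Fourier
  transform below rests on \<open>scaled_passage\<close> and \<open>passage_place_range\<close>: the normalized
  walk overshoots \<open>b\<close> at the place \<open>\<epsilon> S\<^sub>\<beta>\<^sup>+\<close> with \<open>\<beta> = \<lceil>b / \<epsilon>\<rceil>\<close>.\<close>

definition passage_time :: "(nat \<Rightarrow> int) \<Rightarrow> int \<Rightarrow> nat" where
  "passage_time u \<beta> = (LEAST n. 1 \<le> n \<and> \<beta> \<le> walk u n)"

definition scaled_walk :: "nat \<Rightarrow> real \<Rightarrow> (nat \<Rightarrow> int) \<Rightarrow> real \<Rightarrow> real" where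
  "scaled_walk N \<epsilon> u t = \<epsilon> * real_of_int (walk u (nat \<lfloor>t / \<epsilon> ^ (2 * N)\<rfloor>))"

definition scaled_passage_time :: "nat \<Rightarrow> real \<Rightarrow> (nat \<Rightarrow> int) \<Rightarrow> real \<Rightarrow> real" where
  "scaled_passage_time N \<epsilon> u b = Inf {t. 0 \<le> t \<and> b \<le> scaled_walk N \<epsilon> u t}"

lemma passage_timeD:
  assumes "\<exists>n\<ge>1. \<beta> \<le> walk u n"
  shows "1 \<le> passage_time u \<beta>" "\<beta> \<le> walk u (passage_time u \<beta>)"
  using LeastI_ex[of "\<lambda>n. 1 \<le> n \<and> \<beta> \<le> walk u n"] assms
  unfolding passage_time_def by auto

lemma passage_time_le: "1 \<le> n \<Longrightarrow> \<beta> \<le> walk u n \<Longrightarrow> passage_time u \<beta> \<le> n"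
  unfolding passage_time_def by (rule Least_le) simp

lemma scaled_passage:
  assumes "\<epsilon> > 0" "b > 0" and reach: "\<exists>n\<ge>1. \<lceil>b / \<epsilon>\<rceil> \<le> walk u n"
  defines "\<sigma> \<equiv> passage_time u \<lceil>b / \<epsilon>\<rceil>"
  shows "scaled_passage_time N \<epsilon> u b = real \<sigma> * \<epsilon> ^ (2 * N)"
    and "scaled_walk N \<epsilon> u (scaled_passage_time N \<epsilon> u b) = \<epsilon> * real_of_int (walk u \<sigma>)"
proof -
  have pos: "\<epsilon> ^ (2 * N) > 0"
    using assms(1) by simp
  have level: "b \<le> \<epsilon> * real_of_int m \<longleftrightarrow> \<lceil>b / \<epsilon>\<rceil> \<le> m" for m
    using assms(1) by (simp add: ceiling_le_iff field_simps)
  have at: "scaled_walk N \<epsilon> u (real \<sigma> * \<epsilon> ^ (2 * N)) = \<epsilon> * real_of_int (walk u \<sigma>)"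
    using pos by (simp add: scaled_walk_def)
  show "scaled_passage_time N \<epsilon> u b = real \<sigma> * \<epsilon> ^ (2 * N)"
    unfolding scaled_passage_time_def
  proof (rule cInf_eq_minimum)
    show "real \<sigma> * \<epsilon> ^ (2 * N) \<in> {t. 0 \<le> t \<and> b \<le> scaled_walk N \<epsilon> u t}"
      using passage_timeD(2)[OF reach] pos by (simp add: at level) (simp add: \<sigma>_def)
  next
    fix t assume t: "t \<in> {t. 0 \<le> t \<and> b \<le> scaled_walk N \<epsilon> u t}"
    define n where "n = nat \<lfloor>t / \<epsilon> ^ (2 * N)\<rfloor>"
    have n: "b \<le> \<epsilon> * real_of_int (walk u n)"
      using t by (simp add: scaled_walk_def n_def)
    have "n \<noteq> 0"
    proof
      assume "n = 0"
      then show False using n assms(2) by (simp add: walk_def)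
    qed
    then have "\<sigma> \<le> n"
      unfolding \<sigma>_def using n by (intro passage_time_le) (auto simp: level)
    moreover have "real n \<le> t / \<epsilon> ^ (2 * N)"
      using t pos unfolding n_def by (intro of_nat_floor) simp
    ultimately have "real \<sigma> \<le> t / \<epsilon> ^ (2 * N)"
      by linarith
    then show "real \<sigma> * \<epsilon> ^ (2 * N) \<le> t"
      using pos by (simp add: pos_le_divide_eq)
  qed
  then show "scaled_walk N \<epsilon> u (scaled_passage_time N \<epsilon> u b) = \<epsilon> * real_of_int (walk u \<sigma>)"
    by (simp only: at)
qed

lemma passage_place_range:
  assumes "\<beta> \<ge> 1" "\<exists>n\<ge>1. \<beta> \<le> walk u n" "\<And>i. u i \<le> int N"
  shows "walk u (passage_time u \<beta>) \<in> {\<beta>..\<beta> + int N - 1}"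
proof -
  obtain m where m: "passage_time u \<beta> = Suc m"
    using passage_timeD(1)[OF assms(2)] by (cases "passage_time u \<beta>") auto
  have "walk u m < \<beta>"
  proof (cases "m = 0")
    case True
    then show ?thesis using assms(1) by (simp add: walk_def)
  next
    case False
    then show ?thesis using passage_time_le[of m \<beta> u] m by force
  qed
  moreover have "walk u (Suc m) = walk u m + u (Suc m)"
    by (simp add: walk_def)
  ultimately show ?thesis
    using passage_timeD(2)[OF assms(2)] assms(3)[of "Suc m"] m by simp
qed

text \<open>\<open>\<E>(exp (\<i> \<mu> X\<^sub>b\<^sup>\<epsilon>\<^sup>+); \<tau>\<^sub>b\<^sup>\<epsilon>\<^sup>+ < \<infinity>)\<close>\<close>

definition scaled_fourier :: "nat \<Rightarrow> real \<Rightarrow> real \<Rightarrow> real \<Rightarrow> real \<Rightarrow> complex" where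
  "scaled_fourier N c b \<mu> \<epsilon> =
     (\<Sum>l = \<lceil>b / \<epsilon>\<rceil>..\<lceil>b / \<epsilon>\<rceil> + int N - 1.
        exp (\<i> * complex_of_real (\<mu> * \<epsilon> * real_of_int l))
        * complex_of_real (passage_place_prob N c \<lceil>b / \<epsilon>\<rceil> l))"

text \<open>\<open>\<E>(exp (\<i> \<mu> X\<^sub>b\<^sup>+); \<tau>\<^sub>b\<^sup>+ < \<infinity>)\<close>: the pseudo-distribution of \<open>X\<^sub>b\<^sup>+\<close> for pseudo-Brownian motion is
  by definition given by this limit, and \<open>\<P>{\<tau>\<^sub>b\<^sup>+ < \<infinity>}\<close> is the value at \<open>\<mu> = 0\<close>.\<close>

definition limit_fourier :: "nat \<Rightarrow> real \<Rightarrow> real \<Rightarrow> real \<Rightarrow> complex" where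
  "limit_fourier N c b \<mu> = Lim (at_right 0) (scaled_fourier N c b \<mu>)"

definition limit_passage_prob :: "nat \<Rightarrow> real \<Rightarrow> real \<Rightarrow> complex" where
  "limit_passage_prob N c b = limit_fourier N c b 0"

end

theory Submission
  imports Defs "HOL-Complex_Analysis.Cauchy_Integral_Formula" "HOL-Computational_Algebra.Polynomial"
begin

text \<open>Let \<open>P(v) = \<Sum>k. p\<^sub>k v\<^sup>k\<close> be the symbol of the walk. The weights are built from one row of Pascal's triangle, so that
  \<open>P(v) = 1 - (-1)\<^sup>N c (1 - v)\<^sup>2\<^sup>N / v\<^sup>N\<close> (\<open>symbol_eq\<close>). For \<open>0 < z < 1\<close> the equation \<open>z P(v) = 1\<close> therefore has
  exactly \<open>N\<close> solutions outside the unit circle. They are distinct and explicit, and depend analytically on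
  \<open>\<rho> = ((1 - z) / (c z))\<^sup>1\<^sup>/\<^sup>2\<^sup>N\<close> up to and including \<open>\<rho> = 0\<close>, where they all merge at \<open>1\<close>.

  For such a \<open>v\<close> and small \<open>z\<close>, optional stopping of the martingale \<open>z\<^sup>n v\<^bsup>S\<^sub>n\<^esup>\<close> gives
  \<open>\<Sum>m<N. H\<^bsub>\<beta>,\<beta>+m\<^esub>(z) v\<^sup>m = v\<^sup>-\<^sup>\<beta>\<close> (\<open>passage_series_identity\<close>). Thus the \<open>H\<^bsub>\<beta>,\<beta>+m\<^esub>(z)\<close> are the coefficients of the
  remainder of \<open>X\<^sup>-\<^sup>\<beta>\<close> modulo the polynomial \<open>A\<close> with these \<open>N\<close> roots (\<open>passage_series_eq\<close>). The coefficients of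
  the remainder are polynomials in those of \<open>A\<close> and in \<open>1 / A(0)\<close>, hence analytic in \<open>\<rho>\<close>. This provides the
  continuation to \<open>(0,1)\<close>, unique by the identity theorem, and its limit at \<open>z = 1\<close>: there \<open>A\<close> is
  \<open>(X - 1)\<^sup>N\<close> and the remainder is the Taylor polynomial of \<open>X\<^sup>-\<^sup>\<beta>\<close> at \<open>1\<close> (\<open>inv_pow_mod_power_linear\<close>).

  Consequently, with \<open>x = exp (\<i> \<mu> \<epsilon>)\<close>, the Fourier transform of the scaled overshoot is
  \<open>x\<^sup>\<beta> (\<Sum>j<N. binom(-\<beta>, j) (x - 1)\<^sup>j)\<close> (\<open>scaled_fourier_eq\<close>). As \<open>\<beta> \<epsilon>\<close> tends to \<open>b\<close> and
  \<open>(x - 1) / \<epsilon>\<close> to \<open>\<i> \<mu>\<close>, the terms tend to \<open>exp (\<i> \<mu> b) (- \<i> \<mu> b)\<^sup>j / j!\<close>.\<close>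

section \<open>Inverse powers modulo a polynomial\<close>

text \<open>The remainder of \<open>X\<^sup>-\<^sup>n\<close> modulo \<open>A\<close>, of degree below \<open>deg A\<close>, for \<open>A(0) \<noteq> 0\<close>. Multiplication by
  \<open>X\<^sup>-\<^sup>1\<close> in the quotient ring adds the multiple of \<open>A\<close> that kills the constant term and shifts
  the coefficients. This form shows that the coefficients of the remainder are rational in those of \<open>A\<close>,
  with only powers of \<open>A(0)\<close> in the denominator: they stay analytic when roots of \<open>A\<close> collide, whereas
  Lagrange interpolation at the roots becomes singular there.\<close>
primrec inv_pow_mod :: "'a::field poly \<Rightarrow> nat \<Rightarrow> 'a poly" where
  "inv_pow_mod A 0 = 1"
| "inv_pow_mod A (Suc n) = poly_shift 1
     (inv_pow_mod A n - smult (coeff (inv_pow_mod A n) 0 / coeff A 0) A)"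

lemma pCons_poly_shift: "coeff p 0 = 0 \<Longrightarrow> pCons 0 (poly_shift 1 p) = p"
  by (rule poly_eqI) (auto simp: coeff_pCons coeff_poly_shift split: nat.split)

lemma pCons_inv_pow_mod:
  assumes "coeff A 0 \<noteq> 0"
  shows "pCons 0 (inv_pow_mod A (Suc n)) =
    inv_pow_mod A n - smult (coeff (inv_pow_mod A n) 0 / coeff A 0) A"
  unfolding inv_pow_mod.simps by (rule pCons_poly_shift) (use assms in simp)

lemma degree_inv_pow_mod:
  assumes "degree A > 0" "coeff A 0 \<noteq> 0"
  shows "degree (inv_pow_mod A n) < degree A"
proof (induction n)
  case 0
  then show ?case using assms by simp
next
  case (Suc n)
  have "degree (pCons 0 (inv_pow_mod A (Suc n))) \<le> degree A"
    unfolding pCons_inv_pow_mod[OF assms(2)] using Suc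
    by (intro degree_diff_le) (auto intro: order_trans[OF degree_smult_le])
  then show ?case
    using assms(1) by (cases "inv_pow_mod A (Suc n) = 0") (simp_all del: inv_pow_mod.simps)
qed

text \<open>Reducing modulo \<open>A\<close> does not change values at the roots of \<open>A\<close>, so the remainder interpolates
  \<open>x\<^sup>-\<^sup>n\<close> at them.\<close>
lemma inv_pow_mod_root:
  assumes "coeff A 0 \<noteq> 0" "poly A x = 0"
  shows "x ^ n * poly (inv_pow_mod A n) x = 1"
proof (induction n)
  case (Suc n)
  have "x * poly (inv_pow_mod A (Suc n)) x = poly (inv_pow_mod A n) x"
    using arg_cong[OF pCons_inv_pow_mod[OF assms(1), of n], of "\<lambda>p. poly p x"] assms(2)
    by (simp del: inv_pow_mod.simps)
  then have "x ^ Suc n * poly (inv_pow_mod A (Suc n)) x = x ^ n * poly (inv_pow_mod A n) x"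
    by (simp only: power_Suc2 mult.assoc)
  with Suc show ?case by simp
qed simp

text \<open>When all roots collide at \<open>1\<close>, the interpolation becomes Hermite interpolation, and the remainder is the
  Taylor polynomial of \<open>X\<^sup>-\<^sup>n\<close> at \<open>1\<close>. The truncated binomial series obeys the same
  recursion because \<open>X = 1 + (X - 1)\<close> acts on it by Pascal's rule, up to one overflow term, a multiple
  of \<open>(X - 1)\<^sup>N\<close>.\<close>
lemma inv_pow_mod_power_linear:
  fixes N n :: nat
  assumes "N > 0"
  shows "inv_pow_mod ([:-1, 1:] ^ N) n =
    (\<Sum>j<N. smult ((- of_nat n) gchoose j) ([:-1, 1 :: 'a :: field_char_0:] ^ j))"
proof (induction n)
  case 0
  obtain N' where "N = Suc N'" using assms by (cases N) auto
  then show ?case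
    by (auto simp: gbinomial_0_left sum.lessThan_Suc_shift simp del: sum.lessThan_Suc)
next
  case (Suc n)
  let ?Y = "[:-1, 1 :: 'a:]"
  define R where "R n = (\<Sum>j<N. smult ((- of_nat n) gchoose j) (?Y ^ j))" for n
  define a where "a = (- of_nat (Suc n) :: 'a)"
  define g where "g = a gchoose (N - 1)"
  have pasc: "((a + 1) gchoose j) = (a gchoose j) + (if j = 0 then 0 else a gchoose (j - 1))" for j
    using gbinomial_Suc_Suc[of a "j - 1"] by (cases j) auto
  have a1: "- of_nat n = a + 1"
    by (simp add: a_def)
  have "(\<Sum>j<N. smult ((a + 1) gchoose j) (?Y ^ j)) + smult g (?Y ^ N)
      = (\<Sum>j<N. smult (a gchoose j) (?Y ^ j)) + ?Y * (\<Sum>j<N. smult (a gchoose j) (?Y ^ j))"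
    using assms unfolding g_def
  proof (induction N rule: nat_induct_non_zero)
    case 1
    then show ?case by simp
  next
    case (Suc M)
    have M: "((a + 1) gchoose M) = (a gchoose M) + (a gchoose (M - 1))"
      using pasc[of M] Suc.hyps by simp
    have "smult ((a + 1) gchoose M) (?Y ^ M) = smult (a gchoose M) (?Y ^ M) + smult (a gchoose (M - 1)) (?Y ^ M)"
      by (simp only: M smult_add_left)
    with Suc.IH show ?case
      unfolding sum.lessThan_Suc distrib_left mult_smult_right
      by (simp add: algebra_simps del: mult_pCons_left mult_pCons_right)
  qed
  then have eq: "pCons 0 (R (Suc n)) = R n + smult g (?Y ^ N)"
    unfolding R_def a1 a_def[symmetric] by (simp add: algebra_simps)
  have c0: "coeff (?Y ^ N) 0 \<noteq> 0"
    by (simp add: coeff_0_power)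
  \<comment> \<open>Comparing constant terms shows that the overflow term is the correction made by the recursion.\<close>
  have "g = - (coeff (R n) 0 / coeff (?Y ^ N) 0)"
    using arg_cong[OF eq, of "\<lambda>p. coeff p 0"] c0 by (simp add: field_simps eq_neg_iff_add_eq_0)
  with eq have "pCons 0 (R (Suc n)) = pCons 0 (inv_pow_mod (?Y ^ N) (Suc n))"
    unfolding pCons_inv_pow_mod[OF c0] Suc[folded R_def] by simp
  then show ?case
    unfolding R_def by simp
qed

lemma coeff_inv_pow_mod_real:
  fixes A :: "complex poly"
  assumes "\<And>m. coeff A m \<in> \<real>"
  shows "coeff (inv_pow_mod A n) m \<in> \<real>"
proof (induction n arbitrary: m)
  case 0
  then show ?case by (cases m) auto
next
  case (Suc n)
  then show ?case using assms by (auto simp: coeff_poly_shift)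
qed

lemma analytic_on_coeff_prod_linear:
  assumes "finite J" "\<And>j. j \<in> J \<Longrightarrow> (\<lambda>w. f w j) analytic_on S"
  shows "(\<lambda>w. coeff (\<Prod>j\<in>J. [:- f w j, 1:]) m) analytic_on S"
  using assms
proof (induction J arbitrary: m rule: finite_induct)
  case (insert j J)
  show ?case
    using insert by (cases m) (auto intro!: analytic_intros simp: coeff_pCons)
qed simp

lemma analytic_on_coeff_inv_pow_mod:
  assumes "\<And>m. (\<lambda>w. coeff (A w) m) analytic_on S" "\<And>w. w \<in> S \<Longrightarrow> coeff (A w) 0 \<noteq> 0"
  shows "(\<lambda>w. coeff (inv_pow_mod (A w) n) m) analytic_on S"
proof (induction n arbitrary: m)
  case (Suc n)
  then show ?case using assms by (auto simp: coeff_poly_shift intro!: analytic_intros)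
qed simp

section \<open>The roots outside the unit circle\<close>

text \<open>For \<open>t = half_root y\<close> one has \<open>t - 1 / t = y\<close>, so \<open>v = t\<^sup>2\<close> solves
  \<open>(1 - v)\<^sup>2 = y\<^sup>2 v\<close>. Working with \<open>t\<close> instead of \<open>v\<close> turns the choice of the solution outside
  the unit circle into the sign condition \<open>Re y > 0\<close>, and keeps the argument of the square root off the
  branch cut.\<close>
definition half_root :: "complex \<Rightarrow> complex" where
  "half_root y = y / 2 + csqrt (1 + (y / 2)\<^sup>2)"

lemma half_root_inverse: "half_root y * (half_root y - y) = 1"
proof -
  have "half_root y * (half_root y - y) = (csqrt (1 + (y / 2)\<^sup>2))\<^sup>2 - (y / 2)\<^sup>2"
    by (simp add: half_root_def power2_eq_square algebra_simps)
  then show ?thesis by simp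
qed

lemma half_root_nonzero: "half_root y \<noteq> 0"
  using half_root_inverse[of y] by auto

lemma half_root_square: "(1 - (half_root y)\<^sup>2)\<^sup>2 = y\<^sup>2 * (half_root y)\<^sup>2"
proof -
  have "1 - (half_root y)\<^sup>2 = - (y * half_root y)"
    using half_root_inverse[of y] by (simp add: power2_eq_square algebra_simps)
  then show ?thesis by (simp add: power_mult_distrib)
qed

lemma Re_half_root_pos: 
  assumes "Re y > 0" 
  shows "Re (half_root y) > 0"
  using assms csqrt_principal[of "1 + (y / 2)\<^sup>2"] 
  by (auto simp: half_root_def add_pos_nonneg)

text \<open>\<open>Re y = Re t - Re (1 / t) = Re t (1 - 1 / \<bar>t\<bar>\<^sup>2)\<close>, and \<open>Re t > 0\<close>.\<close>
lemma norm_half_root_gt_1: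
  assumes "Re y > 0"
  shows "norm (half_root y) > 1"
proof (rule ccontr)
  define t where "t = half_root y"
  assume "\<not> norm (half_root y) > 1"
  then have "norm t \<le> 1" by (simp add: t_def)
  have t: "t \<noteq> 0" "Re t > 0"
    using half_root_nonzero[of y] Re_half_root_pos[OF assms] by (simp_all add: t_def)
  have inv: "inverse t = t - y"
    using half_root_inverse[of y] t unfolding t_def by (simp add: field_simps)
  have "Re (inverse t) = Re t / (norm t)\<^sup>2"
    by (simp add: complex_div_cnj cmod_power2)
  moreover have "Re t / (norm t)\<^sup>2 \<ge> Re t"
    using t \<open>norm t \<le> 1\<close> by (simp add: field_simps power_le_one)
  ultimately have "Re y \<le> 0"
    unfolding inv by simp
  with assms show False by simp
qed

lemma inj_half_root_square:
  assumes "Re y > 0" "Re y' > 0" "(half_root y)\<^sup>2 = (half_root y')\<^sup>2"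
  shows "y = y'"
proof -
  have "half_root y = half_root y' \<or> half_root y = - half_root y'"
    using assms(3) by (simp add: power2_eq_iff)
  then have "half_root y = half_root y'"
    using Re_half_root_pos[OF assms(1)] Re_half_root_pos[OF assms(2)] by auto
  then have "half_root y * (half_root y - y) = half_root y * (half_root y - y')"
    using half_root_inverse[of y] half_root_inverse[of y'] by simp
  then show ?thesis using half_root_nonzero[of y] by simp
qed

lemma half_root_0: "half_root 0 = 1"
  by (simp add: half_root_def)

text \<open>For \<open>j < N\<close> these are the angles of the \<open>2N\<close>-th roots of \<open>(-1)\<^sup>N\<^sup>+\<^sup>1\<close> in the open right half plane; they are symmetric
  about \<open>0\<close>, with spacing \<open>\<pi> / N\<close>.\<close>
definition angle :: "nat \<Rightarrow> nat \<Rightarrow> real" where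
  "angle N j = pi * (2 * real j + 1 - real N) / (2 * real N)"

definition direction :: "nat \<Rightarrow> nat \<Rightarrow> complex" where
  "direction N j = cis (angle N j)"

lemma direction_power:
  assumes "N > 0"
  shows "direction N j ^ (2 * N) = (- 1) ^ Suc N"
proof -
  have "direction N j ^ (2 * N) = cis (real (2 * N) * angle N j)"
    by (simp only: direction_def Complex.DeMoivre)
  also have "real (2 * N) * angle N j = 2 * pi * of_int (int j - int N) + real (Suc N) * pi"
    using assms by (simp add: angle_def divide_simps) (simp add: algebra_simps)
  also have "cis \<dots> = cis (real (Suc N) * pi)"
    by (simp only: cis_mult[symmetric] cis_multiple_2pi Ints_of_int mult_1_left)
  also have "\<dots> = (- 1) ^ Suc N"
    by (simp only: Complex.DeMoivre[symmetric] cis_pi)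
  finally show ?thesis .
qed

lemma abs_angle_less:
  assumes "j < N"
  shows "\<bar>angle N j\<bar> < pi / 2"
proof -
  have "\<bar>2 * real j + 1 - real N\<bar> < real N"
    using assms by linarith
  then have "\<bar>(2 * real j + 1 - real N) / real N\<bar> * (pi / 2) < 1 * (pi / 2)"
    using assms by (intro mult_strict_right_mono) auto
  then show ?thesis
    by (simp add: angle_def abs_mult mult.commute)
qed

lemma Re_direction_pos: "j < N \<Longrightarrow> Re (direction N j) > 0"
  using abs_angle_less[of j N] by (auto simp: direction_def abs_less_iff intro!: cos_gt_zero_pi)

lemma inj_on_direction: "inj_on (direction N) {..<N}"
proof (rule inj_onI)
  fix i j assume ij: "i \<in> {..<N}" "j \<in> {..<N}" and eq: "direction N i = direction N j"
  have "sin (angle N i) = sin (angle N j)"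
    using arg_cong[OF eq, of Im] by (simp add: direction_def)
  then have "angle N i = angle N j"
    using sin_inj_pi[of "angle N i" "angle N j"] abs_angle_less[of i N] abs_angle_less[of j N] ij
    by (simp add: abs_less_iff)
  then show "i = j" using ij by (auto simp: angle_def)
qed

text \<open>For \<open>\<rho> > 0\<close> the roots are the \<open>N\<close> solutions of \<open>(1 - v)\<^sup>2\<^sup>N = (-1)\<^sup>N\<^sup>+\<^sup>1 \<rho>\<^sup>2\<^sup>N v\<^sup>N\<close> outside the
  unit circle. At \<open>\<rho> = 0\<close> they all become \<open>1\<close>.\<close>
definition root_poly :: "nat \<Rightarrow> complex \<Rightarrow> complex poly" where
  "root_poly N \<rho> = (\<Prod>j<N. [:- (half_root (\<rho> * direction N j))\<^sup>2, 1:])"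

lemma degree_root_poly: "degree (root_poly N \<rho>) = N"
  unfolding root_poly_def by (subst degree_prod_eq_sum_degree) auto

lemma coeff_0_root_poly: "coeff (root_poly N \<rho>) 0 \<noteq> 0"
proof -
  have "coeff (root_poly N \<rho>) 0 = poly (root_poly N \<rho>) 0"
    by (simp add: poly_0_coeff_0)
  then show ?thesis by (simp add: root_poly_def poly_prod half_root_nonzero)
qed

lemma root_poly_0: "root_poly N 0 = [:-1, 1:] ^ N"
  by (simp add: root_poly_def half_root_0)

text \<open>The square root is taken of \<open>1 + d\<^sup>2\<close> with \<open>Re d > 0\<close> or \<open>d = 0\<close>; this is a nonpositive real only for
  \<open>d\<close> on the imaginary axis. The point \<open>\<rho> = 0\<close> is included, and this is what makes the limit
  \<open>z \<longlonglongrightarrow> 1\<close> a matter of continuity.\<close>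
lemma analytic_half_root_direction:
  assumes "j < N"
  shows "(\<lambda>\<rho>. half_root (\<rho> * direction N j)) analytic_on complex_of_real ` {0..}"
  unfolding half_root_def
proof (intro analytic_intros)
  fix w assume "w \<in> complex_of_real ` {0..}"
  then obtain x where x: "w = complex_of_real x" "x \<ge> 0" by auto
  define d where "d = complex_of_real x * direction N j / 2"
  have "x = 0 \<or> Re d > 0"
    using Re_direction_pos[OF assms] x by (cases "x = 0") (auto simp: d_def)
  moreover have "1 + d\<^sup>2 \<notin> \<real>\<^sub>\<le>\<^sub>0" if "Re d > 0"
    using that by (auto simp: complex_nonpos_Reals_iff power2_eq_square not_le add_pos_nonneg)
  moreover have "d = 0" if "x = 0" using that by (simp add: d_def)
  ultimately show "1 + (w * direction N j / 2)\<^sup>2 \<notin> \<real>\<^sub>\<le>\<^sub>0"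
    unfolding x(1) d_def[symmetric] by auto
qed auto

lemma analytic_coeff_inv_pow_mod_root_poly:
  "(\<lambda>\<rho>. coeff (inv_pow_mod (root_poly N \<rho>) n) m) analytic_on complex_of_real ` {0..}"
  unfolding root_poly_def
  by (intro analytic_on_coeff_inv_pow_mod analytic_on_coeff_prod_linear analytic_intros
        analytic_half_root_direction) (auto simp: coeff_0_root_poly[unfolded root_poly_def])

section \<open>The stopped walk for small generating parameter\<close>
lemma sum_PiE_atLeastAtMost_Suc:
  fixes h :: "(nat \<Rightarrow> 'a) \<Rightarrow> 'b :: comm_monoid_add"
  shows "(\<Sum>u \<in> {1..Suc n} \<rightarrow>\<^sub>E K. h u) = (\<Sum>u \<in> {1..n} \<rightarrow>\<^sub>E K. \<Sum>k\<in>K. h (u(Suc n := k)))"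
proof -
  have "{1..Suc n} = insert (Suc n) {1..n}"
    by auto
  then have "(\<Sum>u \<in> {1..Suc n} \<rightarrow>\<^sub>E K. h u) = (\<Sum>(k, u) \<in> K \<times> ({1..n} \<rightarrow>\<^sub>E K). h (u(Suc n := k)))"
    using sum.reindex[OF inj_combinator[of "Suc n" "{1..n}" "\<lambda>_. K"], of h]
    by (simp add: PiE_insert_eq case_prod_unfold comp_def)
  also have "\<dots> = (\<Sum>k\<in>K. \<Sum>u \<in> {1..n} \<rightarrow>\<^sub>E K. h (u(Suc n := k)))"
    by (simp add: sum.cartesian_product)
  also have "\<dots> = (\<Sum>u \<in> {1..n} \<rightarrow>\<^sub>E K. \<Sum>k\<in>K. h (u(Suc n := k)))"
    by (rule sum.swap)
  finally show ?thesis .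
qed

lemma walk_upd: "j \<le> n \<Longrightarrow> walk (u(Suc n := k)) j = walk u j"
  by (auto simp: walk_def intro!: sum.cong)

lemma walk_upd_Suc: "walk (u(Suc n := k)) (Suc n) = walk u n + k"
  using walk_upd[of n n u k] by (simp add: walk_def)

definition path_weight :: "nat \<Rightarrow> real \<Rightarrow> nat \<Rightarrow> (nat \<Rightarrow> int) \<Rightarrow> real" where
  "path_weight N c n u = (\<Prod>i = 1..n. step_weight N c (u i))"

lemma path_weight_upd: "path_weight N c (Suc n) (u(Suc n := k)) = path_weight N c n u * step_weight N c k"
  unfolding path_weight_def by (simp cong: prod.cong_simp)

text \<open>The pseudo-law on paths of length \<open>n\<close> has total mass \<open>1\<close> but total variation the \<open>n\<close>-th power of this
  number, which is why the generating series are controlled only for \<open>z\<close> below its reciprocal.\<close>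
definition total_variation :: "nat \<Rightarrow> real \<Rightarrow> real" where
  "total_variation N c = (\<Sum>k = - int N..int N. \<bar>step_weight N c k\<bar>)"

lemma sum_abs_path_weight:
  "(\<Sum>u \<in> {1..n} \<rightarrow>\<^sub>E {- int N..int N}. \<bar>path_weight N c n u\<bar>) = total_variation N c ^ n"
  unfolding path_weight_def total_variation_def abs_prod
  by (subst prod_sum_PiE[symmetric]) auto

lemma abs_first_passage_prob_le: "\<bar>first_passage_prob N c \<beta> l n\<bar> \<le> total_variation N c ^ n"
proof -
  have "\<bar>first_passage_prob N c \<beta> l n\<bar> \<le> (\<Sum>u | u \<in> {1..n} \<rightarrow>\<^sub>E {- int N..int N} \<and>
      (\<forall>j\<in>{1..<n}. walk u j < \<beta>) \<and> walk u n = l. \<bar>path_weight N c n u\<bar>)"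
    unfolding first_passage_prob_def pseudo_prob_def path_weight_def by (rule sum_abs)
  also have "\<dots> \<le> (\<Sum>u \<in> {1..n} \<rightarrow>\<^sub>E {- int N..int N}. \<bar>path_weight N c n u\<bar>)"
    by (rule sum_mono2) (auto intro!: finite_PiE)
  finally show ?thesis unfolding sum_abs_path_weight .
qed

definition symbol :: "nat \<Rightarrow> real \<Rightarrow> complex \<Rightarrow> complex" where
  "symbol N c v = (\<Sum>k = - int N..int N. of_real (step_weight N c k) * v powi k)"

text \<open>The weights are the coefficients of \<open>(1 - v)\<^sup>2\<^sup>N\<close>, up to sign and a shift by \<open>N\<close>.\<close>
lemma symbol_eq:
  assumes "v \<noteq> 0"
  shows "symbol N c v = 1 - (- 1) ^ N * of_real c * (1 - v) ^ (2 * N) / v ^ N"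
proof -
  have idx: "bij_betw (\<lambda>m. int m - int N) {..2 * N} {- int N..int N}"
    by (rule bij_betwI[where g = "\<lambda>k. nat (k + int N)"]) auto
  have sgn: "(- 1 :: real) powi (int m - int N - 1) = - ((- 1) ^ N * (- 1) ^ m)" for m
    by (simp add: power_int_diff power_int_minus power_inverse[symmetric] divide_inverse)
  have "symbol N c v = (\<Sum>m\<le>2 * N. of_real (step_weight N c (int m - int N)) * v powi (int m - int N))"
    unfolding symbol_def by (rule sum.reindex_bij_betw[OF idx, symmetric])
  also have "\<dots> = (\<Sum>m\<le>2 * N. (if m = N then 1 else 0)
      - (- 1) ^ N * of_real c / v ^ N * (of_nat ((2 * N) choose m) * (- v) ^ m * 1 ^ (2 * N - m)))"
  proof (rule sum.cong[OF refl])
    fix m assume m: "m \<in> {..2 * N}"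
    have "complex_of_real (step_weight N c (int m - int N)) =
      (if m = N then 1 else 0) - (- 1) ^ N * (- 1) ^ m * of_real c * of_nat ((2 * N) choose m)"
      using m by (simp add: step_weight_def sgn)
    moreover have "v powi (int m - int N) = v ^ m / v ^ N"
      using assms by (simp add: power_int_diff)
    ultimately show "of_real (step_weight N c (int m - int N)) * v powi (int m - int N) =
      (if m = N then 1 else 0)
      - (- 1) ^ N * of_real c / v ^ N * (of_nat ((2 * N) choose m) * (- v) ^ m * 1 ^ (2 * N - m))"
      using power_minus[of v m] assms by (simp only:) (auto simp: field_simps)
  qed
  also have "\<dots> = 1 - (- 1) ^ N * of_real c / v ^ N * (- v + 1) ^ (2 * N)"
    unfolding binomial_ring by (simp add: sum_subtractf sum_distrib_left)
  finally show ?thesis by simp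
qed

lemma total_variation_ge_1:
  assumes "N > 0"
  shows "total_variation N c \<ge> 1"
proof -
  have "1 = norm (symbol N c 1)"
    using assms by (simp add: symbol_eq zero_power)
  also have "\<dots> \<le> (\<Sum>k = - int N..int N. norm (complex_of_real (step_weight N c k) * 1 powi k))"
    unfolding symbol_def by (rule norm_sum)
  finally show ?thesis by (simp add: total_variation_def)
qed

text \<open>The half-open range \<open>{1..<Suc n}\<close> is the one in \<^const>\<open>first_passage_prob\<close> for passage at
  time \<open>Suc n\<close>.\<close>
definition below :: "int \<Rightarrow> nat \<Rightarrow> (nat \<Rightarrow> int) \<Rightarrow> bool" where
  "below \<beta> n u \<longleftrightarrow> (\<forall>j\<in>{1..<Suc n}. walk u j < \<beta>)"

lemma below_Suc: "below \<beta> (Suc n) u \<longleftrightarrow> below \<beta> n u \<and> walk u (Suc n) < \<beta>"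
  by (auto simp: below_def less_Suc_eq)

lemma below_upd: "below \<beta> n (u(Suc n := k)) \<longleftrightarrow> below \<beta> n u"
  by (auto simp: below_def walk_upd)

lemma below_walk_less: "\<beta> \<ge> 1 \<Longrightarrow> below \<beta> n u \<Longrightarrow> walk u n < \<beta>"
  by (cases n) (simp_all add: below_def, simp add: walk_def)

text \<open>If \<open>z P(v) = 1\<close> for the symbol \<open>P\<close>, then \<open>z\<^sup>n v\<^bsup>S\<^sub>n\<^esup>\<close> is a martingale. Stopping it at the first passage over
  \<open>\<beta>\<close> gives one linear relation between the generating functions of the overshoot. The part
  that is still alive at time \<open>n\<close> has \<open>S\<^sub>n < \<beta>\<close>; since \<open>\<bar>v\<bar> > 1\<close>, its integrand is at most
  \<open>\<bar>v\<bar>\<^sup>\<beta>\<close> in modulus, so it is at most \<open>(z M)\<^sup>n \<bar>v\<bar>\<^sup>\<beta>\<close> for the total variation \<open>M\<close> and vanishes when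
  \<open>z M < 1\<close>.\<close>
context
  fixes N :: nat and c z :: real and v :: complex and \<beta> :: int
  assumes z: "0 < z" "z * total_variation N c < 1"
    and v: "norm v > 1" "of_real z * symbol N c v = 1"
    and \<beta>: "\<beta> \<ge> 1"
begin

definition mart :: "nat \<Rightarrow> (nat \<Rightarrow> int) \<Rightarrow> complex" where
  "mart n u = of_real (path_weight N c n u) * of_real z ^ n * v powi (walk u n)"

definition alive :: "nat \<Rightarrow> complex" where
  "alive n = (\<Sum>u \<in> {1..n} \<rightarrow>\<^sub>E {- int N..int N}. if below \<beta> n u then mart n u else 0)"

definition stopped :: "nat \<Rightarrow> complex" where
  "stopped n = (\<Sum>u \<in> {1..Suc n} \<rightarrow>\<^sub>E {- int N..int N}.
     if below \<beta> n u \<and> walk u (Suc n) \<ge> \<beta> then mart (Suc n) u else 0)"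

lemma sum_mart_upd: "(\<Sum>k = - int N..int N. mart (Suc n) (u(Suc n := k))) = mart n u"
proof -
  have "v \<noteq> 0" using v(1) by auto
  then have "mart (Suc n) (u(Suc n := k)) =
      mart n u * of_real z * (of_real (step_weight N c k) * v powi k)" for k
    by (simp add: mart_def path_weight_upd walk_upd_Suc power_int_add)
  then have "(\<Sum>k = - int N..int N. mart (Suc n) (u(Suc n := k))) = mart n u * (of_real z * symbol N c v)"
    by (simp add: symbol_def sum_distrib_left mult.assoc)
  then show ?thesis using v(2) by simp
qed

lemma alive_step: "alive n = stopped n + alive (Suc n)"
proof -
  have "alive n = (\<Sum>u \<in> {1..n} \<rightarrow>\<^sub>E {- int N..int N}. \<Sum>k = - int N..int N.
      if below \<beta> n (u(Suc n := k)) then mart (Suc n) (u(Suc n := k)) else 0)"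
    unfolding alive_def below_upd by (intro sum.cong refl) (simp add: sum_mart_upd del: fun_upd_apply)
  also have "\<dots> = (\<Sum>u \<in> {1..Suc n} \<rightarrow>\<^sub>E {- int N..int N}. if below \<beta> n u then mart (Suc n) u else 0)"
    by (rule sum_PiE_atLeastAtMost_Suc[symmetric])
  also have "\<dots> = stopped n + alive (Suc n)"
    unfolding stopped_def alive_def sum.distrib[symmetric] below_Suc by (intro sum.cong) auto
  finally show ?thesis .
qed

lemma sum_stopped: "(\<Sum>k<n. stopped k) = 1 - alive n"
proof (induction n)
  case 0
  show ?case by (simp add: alive_def below_def mart_def path_weight_def walk_def)
next
  case (Suc n)
  then show ?case using alive_step[of n] by simp
qed

lemma norm_alive_le: "norm (alive n) \<le> (z * total_variation N c) ^ n * norm v powi \<beta>"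
proof -
  have "norm (alive n) \<le> (\<Sum>u \<in> {1..n} \<rightarrow>\<^sub>E {- int N..int N}.
      norm (if below \<beta> n u then mart n u else 0))"
    unfolding alive_def by (rule norm_sum)
  also have "\<dots> \<le> (\<Sum>u \<in> {1..n} \<rightarrow>\<^sub>E {- int N..int N}. \<bar>path_weight N c n u\<bar> * (z ^ n * norm v powi \<beta>))"
  proof (rule sum_mono)
    fix u :: "nat \<Rightarrow> int"
    show "norm (if below \<beta> n u then mart n u else 0) \<le> \<bar>path_weight N c n u\<bar> * (z ^ n * norm v powi \<beta>)"
    proof (cases "below \<beta> n u")
      case True
      then have "norm v powi (walk u n) \<le> norm v powi \<beta>"
        using below_walk_less[OF \<beta> True] v(1) by (intro power_int_increasing) auto
      then have "\<bar>path_weight N c n u\<bar> * (z ^ n * norm v powi (walk u n))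
          \<le> \<bar>path_weight N c n u\<bar> * (z ^ n * norm v powi \<beta>)"
        using z(1) by (intro mult_left_mono) auto
      then show ?thesis
        using True z(1) by (simp add: mart_def norm_mult norm_power norm_power_int mult.assoc)
    qed (use z v in auto)
  qed
  also have "\<dots> = (z * total_variation N c) ^ n * norm v powi \<beta>"
    unfolding sum_distrib_right[symmetric] sum_abs_path_weight by (simp add: power_mult_distrib)
  finally show ?thesis .
qed

lemma sums_stopped: "stopped sums 1"
proof -
  have "total_variation N c \<ge> 0"
    unfolding total_variation_def by (rule sum_nonneg) simp
  then have "(\<lambda>n. (z * total_variation N c) ^ n) \<longlonglongrightarrow> 0"
    using z by (intro LIMSEQ_realpow_zero) auto
  then have "(\<lambda>n. (z * total_variation N c) ^ n * norm v powi \<beta>) \<longlonglongrightarrow> 0 * norm v powi \<beta>"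
    by (rule tendsto_mult_right)
  then have "alive \<longlonglongrightarrow> 0"
    using norm_alive_le by (intro Lim_null_comparison[of alive]) (auto intro!: always_eventually)
  then have "(\<lambda>n. 1 - alive n) \<longlonglongrightarrow> 1 - 0"
    by (intro tendsto_intros)
  then show ?thesis by (simp add: sums_def sum_stopped)
qed

text \<open>A step is at most \<open>N\<close>, so the walk can overshoot \<open>\<beta>\<close> only to \<open>\<beta>, \<dots>, \<beta> + N - 1\<close>: grouping the stopped paths by
  their end point leaves \<open>N\<close> terms.\<close>
lemma stopped_eq:
  "stopped n = (\<Sum>l = \<beta>..\<beta> + int N - 1.
     of_real (first_passage_prob N c \<beta> l (Suc n) * z ^ Suc n) * v powi l)"
proof -
  define E where "E = {u \<in> {1..Suc n} \<rightarrow>\<^sub>E {- int N..int N}. below \<beta> n u \<and> walk u (Suc n) \<ge> \<beta>}"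
  have fin: "finite ({1..Suc n} \<rightarrow>\<^sub>E {- int N..int N})"
    by (intro finite_PiE) auto
  have rng: "(\<lambda>u. walk u (Suc n)) ` E \<subseteq> {\<beta>..\<beta> + int N - 1}"
  proof (rule image_subsetI)
    fix u assume u: "u \<in> E"
    have "u (Suc n) \<in> {- int N..int N}"
      using u unfolding E_def by (auto dest: PiE_mem[where x = "Suc n"])
    moreover have "walk u (Suc n) = walk u n + u (Suc n)"
      by (simp add: walk_def)
    moreover have "walk u n < \<beta>"
      using u by (intro below_walk_less \<beta>) (auto simp: E_def)
    ultimately show "walk u (Suc n) \<in> {\<beta>..\<beta> + int N - 1}"
      using u by (auto simp: E_def)
  qed
  have "stopped n = (\<Sum>u\<in>E. mart (Suc n) u)"
    unfolding stopped_def E_def by (rule sum.inter_filter[symmetric]) (rule fin)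
  also have "\<dots> = (\<Sum>l = \<beta>..\<beta> + int N - 1. \<Sum>u | u \<in> E \<and> walk u (Suc n) = l. mart (Suc n) u)"
    by (rule sum.group[symmetric]) (use fin rng in \<open>auto simp: E_def\<close>)
  also have "\<dots> = (\<Sum>l = \<beta>..\<beta> + int N - 1.
     of_real (first_passage_prob N c \<beta> l (Suc n) * z ^ Suc n) * v powi l)"
  proof (rule sum.cong[OF refl])
    fix l assume l: "l \<in> {\<beta>..\<beta> + int N - 1}"
    have E_l: "{u. u \<in> E \<and> walk u (Suc n) = l} =
      {u \<in> {1..Suc n} \<rightarrow>\<^sub>E {- int N..int N}. (\<forall>j\<in>{1..<Suc n}. walk u j < \<beta>) \<and> walk u (Suc n) = l}"
      using l by (auto simp: E_def below_def)
    have "(\<Sum>u | u \<in> E \<and> walk u (Suc n) = l. mart (Suc n) u) =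
      (\<Sum>u | u \<in> E \<and> walk u (Suc n) = l. of_real (path_weight N c (Suc n) u) * (of_real z ^ Suc n * v powi l))"
      by (intro sum.cong) (auto simp: mart_def mult.assoc)
    also have "\<dots> = of_real (first_passage_prob N c \<beta> l (Suc n)) * (of_real z ^ Suc n * v powi l)"
      unfolding first_passage_prob_def pseudo_prob_def E_l path_weight_def
      by (simp only: sum_distrib_right[symmetric] of_real_sum)
    finally show "(\<Sum>u | u \<in> E \<and> walk u (Suc n) = l. mart (Suc n) u) =
      of_real (first_passage_prob N c \<beta> l (Suc n) * z ^ Suc n) * v powi l"
      by (simp add: mult.assoc)
  qed
  finally show ?thesis .
qed

end

definition passage_series :: "nat \<Rightarrow> real \<Rightarrow> int \<Rightarrow> int \<Rightarrow> real \<Rightarrow> real" where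
  "passage_series N c \<beta> l z = (\<Sum>n. first_passage_prob N c \<beta> l (Suc n) * z ^ Suc n)"

lemma passage_series_sums:
  assumes "0 < z" "z * total_variation N c < 1"
  shows "(\<lambda>n. first_passage_prob N c \<beta> l (Suc n) * z ^ Suc n) sums passage_series N c \<beta> l z"
  unfolding passage_series_def
proof (rule summable_sums)
  have "total_variation N c \<ge> 0"
    unfolding total_variation_def by (rule sum_nonneg) simp
  then have "summable (\<lambda>n. (z * total_variation N c) ^ n)"
    using assms by (intro summable_geometric) auto
  then have "summable (\<lambda>n. (z * total_variation N c) ^ Suc n)"
    by (simp only: summable_Suc_iff)
  then show "summable (\<lambda>n. first_passage_prob N c \<beta> l (Suc n) * z ^ Suc n)"
  proof (rule summable_comparison_test')
    fix n
    show "norm (first_passage_prob N c \<beta> l (Suc n) * z ^ Suc n) \<le> (z * total_variation N c) ^ Suc n"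
      unfolding power_mult_distrib norm_mult
      using mult_right_mono[OF abs_first_passage_prob_le[of N c \<beta> l "Suc n"], of "z ^ Suc n"] assms(1)
      by (simp add: mult.commute abs_mult)
  qed
qed

text \<open>Optional stopping. With \<open>N\<close> admissible values of \<open>v\<close> this is a square linear system for the \<open>N\<close> passage
  series.\<close>
lemma passage_series_identity:
  assumes "0 < z" "z * total_variation N c < 1"
    and "norm v > 1" "of_real z * symbol N c v = 1" and "\<beta> \<ge> 1"
  shows "(\<Sum>l = \<beta>..\<beta> + int N - 1. of_real (passage_series N c \<beta> l z) * v powi l) = 1"
proof (rule sums_unique2)
  show "stopped N c z v \<beta> sums 1"
    using assms by (rule sums_stopped)
  show "stopped N c z v \<beta> sums (\<Sum>l = \<beta>..\<beta> + int N - 1. of_real (passage_series N c \<beta> l z) * v powi l)"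
    unfolding stopped_eq[OF assms]
    by (intro sums_sum sums_mult2 sums_of_real passage_series_sums assms)
qed

section \<open>Real-analytic functions on an interval\<close>
lemma real_analytic_on_Re:
  assumes "f analytic_on complex_of_real ` A"
  shows "real_analytic_on (\<lambda>x. Re (f (complex_of_real x))) A"
  unfolding real_analytic_on_def
proof
  fix x assume "x \<in> A"
  then obtain r where r: "r > 0" "f holomorphic_on ball (complex_of_real x) r"
    using assms unfolding analytic_on_def by auto
  define a where "a n = (deriv ^^ n) f (complex_of_real x) / fact n" for n
  have "(\<lambda>n. Re (a n) * (y - x) ^ n) sums Re (f (complex_of_real y))" if "\<bar>y - x\<bar> < r" for y
  proof -
    have "complex_of_real y \<in> ball (complex_of_real x) r"
      using that by (simp add: dist_norm abs_minus_commute flip: of_real_diff)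
    then have "(\<lambda>n. a n * complex_of_real ((y - x) ^ n)) sums f (complex_of_real y)"
      using holomorphic_power_series[OF r(2)] by (simp add: a_def)
    from sums_Re[OF this] show ?thesis by simp
  qed
  then show "\<exists>r>0. \<exists>a. \<forall>y. \<bar>y - x\<bar> < r \<longrightarrow> (\<lambda>n. a n * (y - x) ^ n) sums Re (f (complex_of_real y))"
    using r(1) by (intro exI[of _ r] conjI exI[of _ "\<lambda>n. Re (a n)"]) auto
qed

lemma real_analytic_on_diff:
  assumes "real_analytic_on f A" "real_analytic_on g A"
  shows "real_analytic_on (\<lambda>x. f x - g x) A"
  unfolding real_analytic_on_def
proof
  fix x assume "x \<in> A"
  then obtain r a s b where r: "r > 0" "\<And>y. \<bar>y - x\<bar> < r \<Longrightarrow> (\<lambda>n. a n * (y - x) ^ n) sums f y"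
    and s: "s > 0" "\<And>y. \<bar>y - x\<bar> < s \<Longrightarrow> (\<lambda>n. b n * (y - x) ^ n) sums g y"
    using assms unfolding real_analytic_on_def by meson
  have "(\<lambda>n. (a n - b n) * (y - x) ^ n) sums (f y - g y)" if "\<bar>y - x\<bar> < min r s" for y
    using sums_diff[OF r(2) s(2)] that by (simp add: left_diff_distrib)
  then show "\<exists>r>0. \<exists>a. \<forall>y. \<bar>y - x\<bar> < r \<longrightarrow> (\<lambda>n. a n * (y - x) ^ n) sums (f y - g y)"
    using r(1) s(1) by (intro exI[of _ "min r s"] conjI exI[of _ "\<lambda>n. a n - b n"]) auto
qed

text \<open>Zeros of a nonzero power series are isolated. Multiplying the function by \<open>y - x\<close> makes it vanish at the
  centre, so that a nonzero value there needs no separate treatment.\<close>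
lemma power_series_dichotomy:
  fixes d :: "real \<Rightarrow> real"
  assumes "r > 0" and d: "\<And>y. \<bar>y - x\<bar> < r \<Longrightarrow> (\<lambda>n. a n * (y - x) ^ n) sums d y"
  shows "(\<forall>y. \<bar>y - x\<bar> < r \<longrightarrow> d y = 0) \<or> (\<exists>s>0. \<forall>y. 0 < \<bar>y - x\<bar> \<and> \<bar>y - x\<bar> < s \<longrightarrow> d y \<noteq> 0)"
proof (cases "\<forall>n. a n = 0")
  case True
  then have "d y = 0" if "\<bar>y - x\<bar> < r" for y
    using d[OF that] by (simp add: sums_unique2[OF _ sums_zero])
  then show ?thesis by blast
next
  case False
  then obtain m where "a m \<noteq> 0" by blast
  define a' where "a' n = (case n of 0 \<Rightarrow> 0 | Suc k \<Rightarrow> a k)" for n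
  have "(\<lambda>n. a' n * (y - x) ^ n) sums (d y * (y - x))" if "norm (y - x) < r" for y
  proof -
    have "(\<lambda>n. a' (Suc n) * (y - x) ^ Suc n) sums (d y * (y - x))"
      using sums_mult2[OF d[of y], of "y - x"] that by (simp add: a'_def mult_ac)
    then show ?thesis
      unfolding sums_Suc_iff[of "\<lambda>n. a' n * (y - x) ^ n"] by (simp add: a'_def)
  qed
  then obtain s where "s > 0" "\<And>y. y \<in> cball x s - {x} \<Longrightarrow> d y * (y - x) \<noteq> 0"
    using powser_0_nonzero[of r x a' "\<lambda>y. d y * (y - x)" "Suc m"] \<open>a m \<noteq> 0\<close> assms(1)
    by (auto simp: a'_def)
  then show ?thesis
    by (intro disjI2 exI[of _ s]) (auto simp: dist_real_def abs_minus_commute)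
qed

text \<open>The points near which the two functions agree form an open set, and by the dichotomy so do the
  remaining points of the interval; connectedness leaves only one of the two.\<close>
lemma real_analytic_identity:
  assumes "real_analytic_on f {0<..<1}" "real_analytic_on g {0<..<1}"
    and "\<delta> > 0" and eq: "\<And>x. 0 < x \<Longrightarrow> x < \<delta> \<Longrightarrow> f x = g x"
    and x: "x \<in> {0<..<1}"
  shows "f x = g x"
proof -
  define d where "d x = f x - g x" for x
  define S where "S = {x \<in> {0<..<1}. \<exists>r>0. \<forall>y. \<bar>y - x\<bar> < r \<longrightarrow> d y = 0}"
  have "real_analytic_on d {0<..<1}"
    unfolding d_def by (rule real_analytic_on_diff) fact+
  then have dich: "x \<in> S \<or> (\<exists>s>0. \<forall>y. 0 < \<bar>y - x\<bar> \<and> \<bar>y - x\<bar> < s \<longrightarrow> d y \<noteq> 0)" if x01: "x \<in> {0<..<1}" for x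
  proof -
    obtain r a where r: "r > 0" "\<And>y. \<bar>y - x\<bar> < r \<Longrightarrow> (\<lambda>n. a n * (y - x) ^ n) sums d y"
      using \<open>real_analytic_on d {0<..<1}\<close> x01 unfolding real_analytic_on_def by blast
    show ?thesis
      using power_series_dichotomy[OF r] r(1) x01 unfolding S_def by blast
  qed
  have "open S"
  proof -
    have "\<exists>e>0. ball x e \<subseteq> S" if xS: "x \<in> S" for x
    proof -
      obtain r where r: "r > 0" "\<And>y. \<bar>y - x\<bar> < r \<Longrightarrow> d y = 0" and x: "0 < x" "x < 1"
        using xS unfolding S_def by auto
      define e where "e = min (r / 2) (min x (1 - x))"
      have "y \<in> S" if "\<bar>y - x\<bar> < e" for y
        unfolding S_def
      proof (intro CollectI conjI exI[of _ "r / 2"] allI impI)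
        show "d w = 0" if "\<bar>w - y\<bar> < r / 2" for w
        proof (rule r(2))
          have "\<bar>y - x\<bar> < r / 2" using \<open>\<bar>y - x\<bar> < e\<close> by (simp add: e_def)
          with that show "\<bar>w - x\<bar> < r" by linarith
        qed
        have "\<bar>y - x\<bar> < x" "\<bar>y - x\<bar> < 1 - x" using that by (simp_all add: e_def)
        then show "y \<in> {0<..<1}" by auto
      qed (use r in simp)
      then show ?thesis
        using r x by (intro exI[of _ e]) (auto simp: e_def dist_real_def abs_minus_commute)
    qed
    then show ?thesis unfolding open_contains_ball by blast
  qed
  moreover have "open ({0<..<1} - S)"
    unfolding open_contains_ball
  proof
    fix x assume xS: "x \<in> {0<..<1} - S"
    then obtain s where s: "s > 0" "\<And>y. 0 < \<bar>y - x\<bar> \<Longrightarrow> \<bar>y - x\<bar> < s \<Longrightarrow> d y \<noteq> 0"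
      using dich[of x] by blast
    define e where "e = min s (min x (1 - x))"
    have near: "y \<in> {0<..<1} - S" if "\<bar>y - x\<bar> < e" for y
    proof (cases "y = x")
      case False
      then have "d y \<noteq> 0"
        using that by (intro s(2)) (auto simp: e_def)
      then have "y \<notin> S" unfolding S_def by force
      moreover have "\<bar>y - x\<bar> < x" "\<bar>y - x\<bar> < 1 - x" using that by (simp_all add: e_def)
      then have "y \<in> {0<..<1}" by auto
      ultimately show ?thesis by blast
    qed (use xS in simp)
    have "e > 0" using s(1) xS by (simp add: e_def)
    moreover have "ball x e \<subseteq> {0<..<1} - S"
    proof
      fix y assume "y \<in> ball x e"
      then show "y \<in> {0<..<1} - S"
        by (intro near) (simp add: dist_real_def abs_minus_commute)
    qed
    ultimately show "\<exists>e>0. ball x e \<subseteq> {0<..<1} - S" by blast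
  qed
  ultimately have "S \<inter> {0<..<1} = {} \<or> ({0<..<1} - S) \<inter> {0<..<1} = {}"
    by (intro connectedD[OF connected_Ioo]) auto
  moreover have "min \<delta> 1 / 2 \<in> S"
    unfolding S_def
  proof (intro CollectI conjI exI[of _ "min \<delta> 1 / 2"] allI impI)
    fix y assume "\<bar>y - min \<delta> 1 / 2\<bar> < min \<delta> 1 / 2"
    then have "0 < y" "y < min \<delta> 1" by linarith+
    then show "d y = 0" by (simp add: d_def eq)
  qed (use assms(3) in auto)
  moreover have "S \<subseteq> {0<..<1}" unfolding S_def by blast
  ultimately have "x \<in> S" using x by blast
  then show ?thesis by (auto simp: S_def d_def)
qed

section \<open>The continued generating functions and their limit\<close>

text \<open>The principal \<open>\<rho>\<close> with \<open>\<rho>\<^sup>2\<^sup>N = (1 - z) / (c z)\<close>. With it, \<open>z P(v) = 1\<close> becomes the equation whose outer solutions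
  are the roots of \<^const>\<open>root_poly\<close>.\<close>
definition root_scale :: "nat \<Rightarrow> real \<Rightarrow> complex \<Rightarrow> complex" where
  "root_scale N c w = ((1 - w) / (of_real c * w)) powr of_real (1 / (2 * real N))"

definition continued_gf :: "nat \<Rightarrow> real \<Rightarrow> nat \<Rightarrow> nat \<Rightarrow> complex \<Rightarrow> complex" where
  "continued_gf N c n m w = coeff (inv_pow_mod (root_poly N (root_scale N c w)) n) m"

lemma root_scale_of_real:
  assumes "c > 0" "0 < z" "z < 1"
  shows "root_scale N c (of_real z) = of_real (((1 - z) / (c * z)) powr (1 / (2 * real N)))"
  using assms powr_of_real[of "(1 - z) / (c * z)" "1 / (2 * real N)"] by (simp add: root_scale_def)

lemma analytic_continued_gf:
  assumes "c > 0"
  shows "continued_gf N c n m analytic_on complex_of_real ` {0<..<1}"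
proof -
  have "root_scale N c analytic_on complex_of_real ` {0<..<1}"
    unfolding root_scale_def
  proof (intro analytic_intros)
    fix w assume "w \<in> complex_of_real ` {0<..<1}"
    then obtain z where z: "w = of_real z" "0 < z" "z < 1" by auto
    have "(1 - w) / (of_real c * w) = of_real ((1 - z) / (c * z))" by (simp add: z)
    also have "\<dots> \<notin> \<real>\<^sub>\<le>\<^sub>0"
      using z assms by (simp add: complex_nonpos_Reals_iff not_le)
    finally show "(1 - w) / (of_real c * w) \<notin> \<real>\<^sub>\<le>\<^sub>0" .
  qed (use assms in auto)
  moreover have "root_scale N c w \<in> complex_of_real ` {0..}" if "w \<in> complex_of_real ` {0<..<1}" for w
    using that root_scale_of_real[OF assms, of _ N] by auto
  ultimately have "((\<lambda>\<rho>. coeff (inv_pow_mod (root_poly N \<rho>) n) m) \<circ> root_scale N c)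
      analytic_on complex_of_real ` {0<..<1}"
    by (rule analytic_on_compose_gen[OF _ analytic_coeff_inv_pow_mod_root_poly])
  then show ?thesis by (simp add: continued_gf_def[abs_def] comp_def)
qed

text \<open>As \<open>z\<close> increases to \<open>1\<close> the scale of the roots tends to \<open>0\<close>, where the remainder is still continuous
  although all roots merge.\<close>
lemma continued_gf_tendsto:
  assumes "c > 0" "N > 0"
  shows "((\<lambda>z. continued_gf N c n m (of_real z)) \<longlongrightarrow> coeff (inv_pow_mod ([:-1, 1:] ^ N) n) m) (at_left 1)"
proof -
  have ev: "eventually (\<lambda>z::real. z \<in> {0<..<1}) (at_left 1)"
    by (rule eventually_at_left_real) simp
  have "((\<lambda>z. ((1 - z) / (c * z)) powr (1 / (2 * real N))) \<longlongrightarrow> ((1 - 1) / (c * 1)) powr (1 / (2 * real N))) (at_left 1)"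
    using assms by (intro tendsto_powr' tendsto_intros disjI2 conjI eventually_mono[OF ev]) auto
  then have "((\<lambda>z. complex_of_real (((1 - z) / (c * z)) powr (1 / (2 * real N)))) \<longlongrightarrow> of_real 0) (at_left 1)"
    by (intro tendsto_intros) simp
  then have "((\<lambda>z. root_scale N c (of_real z)) \<longlongrightarrow> 0) (at_left 1)"
    unfolding of_real_0
    by (rule Lim_transform_eventually) (use ev assms in \<open>auto elim!: eventually_mono simp: root_scale_of_real\<close>)
  moreover have "isCont (\<lambda>\<rho>. coeff (inv_pow_mod (root_poly N \<rho>) n) m) 0"
    by (intro analytic_at_imp_isCont analytic_on_subset[OF analytic_coeff_inv_pow_mod_root_poly]) force
  ultimately show ?thesis
    unfolding continued_gf_def root_poly_0[symmetric] by (rule isCont_tendsto_compose[rotated])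
qed

lemma outer_roots:
  assumes "c > 0" "N > 0" "0 < z" "z < 1" "j < N"
  defines "y \<equiv> root_scale N c (of_real z) * direction N j"
  shows "Re y > 0" "norm ((half_root y)\<^sup>2) > 1" "of_real z * symbol N c ((half_root y)\<^sup>2) = 1"
proof -
  define r where "r = (1 - z) / (c * z)"
  define \<rho> where "\<rho> = r powr (1 / (2 * real N))"
  have "r > 0" using assms by (simp add: r_def)
  then have "\<rho> > 0" by (simp add: \<rho>_def)
  have "\<rho> ^ (2 * N) = r"
    using \<open>r > 0\<close> \<open>\<rho> > 0\<close> assms by (simp add: \<rho>_def powr_powr flip: powr_realpow)
  have y: "y = of_real \<rho> * direction N j"
    using assms by (simp add: y_def root_scale_of_real \<rho>_def r_def)
  show "Re y > 0"
    using \<open>\<rho> > 0\<close> Re_direction_pos[OF assms(5)] by (simp add: y)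
  then show "norm ((half_root y)\<^sup>2) > 1"
    using norm_half_root_gt_1[of y] by (simp add: norm_power one_less_power)
  define v where "v = (half_root y)\<^sup>2"
  have "v \<noteq> 0" by (simp add: v_def half_root_nonzero)
  have "(1 - v) ^ (2 * N) / v ^ N = (y\<^sup>2) ^ N"
    using \<open>v \<noteq> 0\<close> half_root_square[of y] by (simp add: power_mult v_def power_mult_distrib half_root_nonzero)
  also have "\<dots> = of_real r * (- 1) ^ Suc N"
    using direction_power[OF assms(2), of j] \<open>\<rho> ^ (2 * N) = r\<close>
    by (simp add: y power_mult_distrib flip: power_mult of_real_power)
  finally have "symbol N c v = 1 + of_real (c * r)"
    using symbol_eq[OF \<open>v \<noteq> 0\<close>, of N c] by (simp add: mult.assoc[symmetric] flip: times_divide_eq_right)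
  moreover have "z * (1 + c * r) = 1"
    using assms by (simp add: r_def field_simps)
  ultimately show "of_real z * symbol N c ((half_root y)\<^sup>2) = 1"
    unfolding v_def by (metis of_real_1 of_real_add of_real_mult)
qed

lemma sum_overshoot:
  fixes f :: "int \<Rightarrow> 'a :: comm_monoid_add"
  shows "(\<Sum>l = \<beta>..\<beta> + int N - 1. f l) = (\<Sum>m<N. f (\<beta> + int m))"
  by (rule sum.reindex_bij_betw[symmetric], rule bij_betwI[where g = "\<lambda>l. nat (l - \<beta>)"]) auto

text \<open>By optional stopping, the polynomial whose coefficients are the passage series takes the value
  \<open>v\<^sup>-\<^sup>\<beta>\<close> at each of the \<open>N\<close> outer roots \<open>v\<close>. The remainder of \<open>X\<^sup>-\<^sup>\<beta>\<close> does the same; both have degree below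
  \<open>N\<close> and the roots are distinct, so the two polynomials agree.\<close>
lemma passage_series_eq:
  assumes "c > 0" "N > 0" "0 < z" "z * total_variation N c < 1" "\<beta> \<ge> 1" "m < N"
  shows "of_real (passage_series N c \<beta> (\<beta> + int m) z) = continued_gf N c (nat \<beta>) m (of_real z)"
proof -
  define \<rho> where "\<rho> = root_scale N c (of_real z)"
  define v where "v j = (half_root (\<rho> * direction N j))\<^sup>2" for j
  have "z < 1"
  proof (rule ccontr)
    assume "\<not> z < 1"
    then have "1 * 1 \<le> z * total_variation N c"
      using total_variation_ge_1[OF assms(2)] by (intro mult_mono) auto
    with assms show False by simp
  qed
  note roots = outer_roots[OF assms(1-3) this, folded \<rho>_def, folded v_def]
  have "\<rho> \<noteq> 0"
    using roots(1)[of 0] assms(2) by auto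
  have "inj_on v {..<N}"
    using inj_half_root_square roots(1) inj_on_direction \<open>\<rho> \<noteq> 0\<close>
    unfolding inj_on_def v_def by (metis lessThan_iff mult_cancel_left)
  then have card: "card (v ` {..<N}) = N"
    by (simp add: card_image)
  define p where "p = (\<Sum>m<N. monom (complex_of_real (passage_series N c \<beta> (\<beta> + int m) z)) m)"
  have coeff_p: "coeff p m = (if m < N then of_real (passage_series N c \<beta> (\<beta> + int m) z) else 0)" for m
    by (auto simp: p_def coeff_sum)
  have "p = inv_pow_mod (root_poly N \<rho>) (nat \<beta>)"
  proof (rule poly_eqI_degree[of "v ` {..<N}"])
    fix x assume "x \<in> v ` {..<N}"
    then obtain j where j: "j < N" "x = v j" by auto
    have "x \<noteq> 0" using roots(2)[OF j(1)] j by auto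
    have pw: "x powi (\<beta> + int m) = x ^ nat \<beta> * x ^ m" for m
      using assms(5) by (simp add: power_int_nonneg_exp nat_add_distrib power_add)
    have "(\<Sum>m<N. of_real (passage_series N c \<beta> (\<beta> + int m) z) * (x ^ nat \<beta> * x ^ m)) = 1"
      using passage_series_identity[OF assms(3,4) roots(2,3)[OF j(1)] assms(5)]
      unfolding sum_overshoot j(2)[symmetric] pw .
    then have "x ^ nat \<beta> * poly p x = 1"
      by (simp add: p_def poly_sum poly_monom sum_distrib_left mult_ac)
    moreover have "poly (root_poly N \<rho>) x = 0"
      using j by (auto simp: root_poly_def poly_prod v_def)
    from inv_pow_mod_root[OF coeff_0_root_poly this]
    have "x ^ nat \<beta> * poly (inv_pow_mod (root_poly N \<rho>) (nat \<beta>)) x = 1" .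
    ultimately show "poly p x = poly (inv_pow_mod (root_poly N \<rho>) (nat \<beta>)) x"
      using \<open>x \<noteq> 0\<close> by (metis mult_cancel_left power_not_zero)
  next
    show "degree p < card (v ` {..<N})"
      unfolding card by (rule degree_lessI) (use assms in \<open>auto simp: coeff_p\<close>)
    show "degree (inv_pow_mod (root_poly N \<rho>) (nat \<beta>)) < card (v ` {..<N})"
      unfolding card using degree_inv_pow_mod[of "root_poly N \<rho>"] assms(2)
      by (simp add: degree_root_poly coeff_0_root_poly)
  qed
  then show ?thesis
    using coeff_p[of m] assms(6) by (simp add: continued_gf_def \<rho>_def)
qed

lemma is_continuation_continued_gf:
  assumes "c > 0" "N > 0" "\<beta> \<ge> 1" "m < N"
  shows "is_continuation N c \<beta> (\<beta> + int m) (\<lambda>z. Re (continued_gf N c (nat \<beta>) m (of_real z)))"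
  unfolding is_continuation_def total_variation_def[symmetric]
proof (intro conjI allI impI)
  show "real_analytic_on (\<lambda>z. Re (continued_gf N c (nat \<beta>) m (of_real z))) {0<..<1}"
    using assms by (intro real_analytic_on_Re analytic_continued_gf)
  fix z assume "0 < z \<and> z < 1 / total_variation N c"
  then have z: "0 < z" "z * total_variation N c < 1"
    using total_variation_ge_1[OF assms(2), of c] by (auto simp: field_simps)
  show "(\<lambda>k. first_passage_prob N c \<beta> (\<beta> + int m) (Suc k) * z ^ Suc k) sums
      Re (continued_gf N c (nat \<beta>) m (of_real z))"
    using passage_series_sums[OF z, of \<beta> "\<beta> + int m"] passage_series_eq[OF assms(1,2) z assms(3,4)]
    by (metis Re_complex_of_real)
qed

lemma is_continuation_unique:
  assumes "N > 0" "is_continuation N c \<beta> l f" "is_continuation N c \<beta> l g" "x \<in> {0<..<1}"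
  shows "f x = g x"
proof (rule real_analytic_identity[of f g "1 / total_variation N c"])
  show "0 < 1 / total_variation N c"
    using total_variation_ge_1[OF assms(1), of c] by auto
  fix y assume "0 < y" "y < 1 / total_variation N c"
  with assms(2,3) show "f y = g y"
    unfolding is_continuation_def total_variation_def by (blast intro: sums_unique2)
qed (use assms in \<open>auto simp: is_continuation_def\<close>)

text \<open>The remainders are complex by construction. Their limit coefficients are real because \<open>(X - 1)\<^sup>N\<close> has real
  coefficients, so passing to the real part loses nothing.\<close>
lemma passage_gf_limit:
  assumes "c > 0" "N > 0" "\<beta> \<ge> 1" "m < N"
  shows "is_continuation N c \<beta> (\<beta> + int m) (passage_gf N c \<beta> (\<beta> + int m))"
    and "(passage_gf N c \<beta> (\<beta> + int m) \<longlongrightarrow> passage_place_prob N c \<beta> (\<beta> + int m)) (at_left 1)"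
    and "of_real (passage_place_prob N c \<beta> (\<beta> + int m)) = coeff (inv_pow_mod ([:-1, 1 :: complex:] ^ N) (nat \<beta>)) m"
proof -
  note cont = is_continuation_continued_gf[OF assms]
  show gf: "is_continuation N c \<beta> (\<beta> + int m) (passage_gf N c \<beta> (\<beta> + int m))"
    unfolding passage_gf_def by (rule someI[of "is_continuation N c \<beta> (\<beta> + int m)"]) (rule cont)
  define L where "L = coeff (inv_pow_mod ([:-1, 1 :: complex:] ^ N) (nat \<beta>)) m"
  have "((\<lambda>z. Re (continued_gf N c (nat \<beta>) m (of_real z))) \<longlongrightarrow> Re L) (at_left 1)"
    unfolding L_def by (intro tendsto_Re continued_gf_tendsto assms)
  moreover have "eventually (\<lambda>z. Re (continued_gf N c (nat \<beta>) m (of_real z)) = passage_gf N c \<beta> (\<beta> + int m) z) (at_left 1)"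
    using eventually_at_left_real[of 0 "1 :: real"]
    by (rule eventually_mono) (use is_continuation_unique[OF assms(2) cont gf] in auto)
  ultimately have lim: "(passage_gf N c \<beta> (\<beta> + int m) \<longlongrightarrow> Re L) (at_left 1)"
    by (rule Lim_transform_eventually)
  then have place: "passage_place_prob N c \<beta> (\<beta> + int m) = Re L"
    unfolding passage_place_prob_def by (rule tendsto_Lim[OF trivial_limit_at_left_real])
  with lim show "(passage_gf N c \<beta> (\<beta> + int m) \<longlongrightarrow> passage_place_prob N c \<beta> (\<beta> + int m)) (at_left 1)"
    by simp
  have "coeff ([:-1, 1 :: complex:] ^ N) k \<in> \<real>" for k
    by (induction N arbitrary: k) (auto simp: coeff_pCons split: nat.split)
  then have "L \<in> \<real>"
    unfolding L_def by (rule coeff_inv_pow_mod_real)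
  then show "of_real (passage_place_prob N c \<beta> (\<beta> + int m)) = coeff (inv_pow_mod ([:-1, 1 :: complex:] ^ N) (nat \<beta>)) m"
    by (simp add: place L_def[symmetric])
qed

section \<open>Rescaling the walk\<close>

text \<open>Up to the phase \<open>x\<^sup>n\<close> of the level itself, the Fourier transform is the Taylor polynomial of \<open>X\<^sup>-\<^sup>n\<close> at \<open>1\<close>,
  evaluated at the point \<open>x\<close> of the unit circle.\<close>
lemma scaled_fourier_eq:
  fixes \<mu> :: real
  assumes "c > 0" "N > 0" "b > 0" "\<epsilon> > 0"
  defines "n \<equiv> nat \<lceil>b / \<epsilon>\<rceil>" and "x \<equiv> exp (\<i> * complex_of_real (\<mu> * \<epsilon>))"
  shows "scaled_fourier N c b \<mu> \<epsilon> = x ^ n * (\<Sum>j<N. ((- of_nat n) gchoose j) * (x - 1) ^ j)"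
proof -
  define \<beta> where "\<beta> = \<lceil>b / \<epsilon>\<rceil>"
  define Q where "Q = inv_pow_mod ([:-1, 1 :: complex:] ^ N) n"
  have "b / \<epsilon> > 0" using assms by simp
  then have \<beta>: "\<beta> \<ge> 1" unfolding \<beta>_def by linarith
  have ex: "exp (\<i> * complex_of_real (\<mu> * \<epsilon> * real_of_int (\<beta> + int m))) = x ^ n * x ^ m" for m
  proof -
    have "real_of_int (\<beta> + int m) = real (n + m)"
      using \<beta> by (simp add: n_def \<beta>_def[symmetric])
    then have "\<i> * complex_of_real (\<mu> * \<epsilon> * real_of_int (\<beta> + int m))
        = of_nat (n + m) * (\<i> * complex_of_real (\<mu> * \<epsilon>))"
      by (simp only: of_real_mult of_real_of_nat_eq mult_ac)
    then show ?thesis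
      unfolding x_def by (simp only: power_add[symmetric] exp_of_nat_mult)
  qed
  have "degree Q < N"
    unfolding Q_def using degree_inv_pow_mod[of "[:-1, 1 :: complex:] ^ N" n] assms(2)
    by (simp add: degree_power_eq coeff_0_power)
  have "scaled_fourier N c b \<mu> \<epsilon> = (\<Sum>m<N. x ^ n * x ^ m * coeff Q m)"
    unfolding scaled_fourier_def \<beta>_def[symmetric] sum_overshoot ex
    by (intro sum.cong refl) (use passage_gf_limit(3)[OF assms(1,2) \<beta>] in \<open>simp add: Q_def n_def \<beta>_def\<close>)
  also have "\<dots> = x ^ n * poly Q x"
  proof -
    have "poly Q x = (\<Sum>m<N. coeff Q m * x ^ m)"
      unfolding poly_altdef using \<open>degree Q < N\<close>
      by (intro sum.mono_neutral_left) (auto simp: coeff_eq_0)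
    then show ?thesis by (simp add: sum_distrib_left mult_ac)
  qed
  also have "poly Q x = (\<Sum>j<N. ((- of_nat n) gchoose j) * (x - 1) ^ j)"
    unfolding Q_def inv_pow_mod_power_linear[OF assms(2)] by (simp add: poly_sum)
  finally show ?thesis .
qed

lemma scaled_level_tendsto:
  assumes "b > 0"
  shows "((\<lambda>\<epsilon>. real (nat \<lceil>b / \<epsilon>\<rceil>) * \<epsilon>) \<longlongrightarrow> b) (at_right 0)"
proof (rule tendsto_sandwich)
  have ev: "eventually (\<lambda>\<epsilon>::real. \<epsilon> > 0) (at_right 0)"
    by (rule eventually_at_right_less)
  show "((\<lambda>\<epsilon>. b) \<longlongrightarrow> b) (at_right 0)" by simp
  show "((\<lambda>\<epsilon>. b + \<epsilon>) \<longlongrightarrow> b) (at_right 0)"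
    by (rule tendsto_eq_intros refl)+ simp
  have pt: "b \<le> real (nat \<lceil>b / \<epsilon>\<rceil>) * \<epsilon> \<and> real (nat \<lceil>b / \<epsilon>\<rceil>) * \<epsilon> \<le> b + \<epsilon>" if "\<epsilon> > 0" for \<epsilon>
  proof -
    have "b / \<epsilon> > 0" using assms that by simp
    then have "b / \<epsilon> \<le> real (nat \<lceil>b / \<epsilon>\<rceil>)" "real (nat \<lceil>b / \<epsilon>\<rceil>) \<le> b / \<epsilon> + 1"
      by linarith+
    then show ?thesis using that by (simp add: field_simps)
  qed
  show "eventually (\<lambda>\<epsilon>. b \<le> real (nat \<lceil>b / \<epsilon>\<rceil>) * \<epsilon>) (at_right 0)"
    "eventually (\<lambda>\<epsilon>. real (nat \<lceil>b / \<epsilon>\<rceil>) * \<epsilon> \<le> b + \<epsilon>) (at_right 0)"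
    using pt by (auto intro: eventually_mono[OF ev])
qed

lemma exp_difference_quotient_tendsto:
  "((\<lambda>\<epsilon>. (exp (\<i> * complex_of_real (\<mu> * \<epsilon>)) - 1) / complex_of_real \<epsilon>) \<longlongrightarrow> \<i> * complex_of_real \<mu>) (at_right 0)"
proof -
  have "((\<lambda>w. exp (\<i> * complex_of_real \<mu> * w)) has_field_derivative (\<i> * complex_of_real \<mu>)) (at 0)"
    by (auto intro!: derivative_eq_intros)
  then have "((\<lambda>w. (exp (\<i> * complex_of_real \<mu> * w) - 1) / w) \<longlongrightarrow> \<i> * complex_of_real \<mu>) (at 0)"
    by (simp add: DERIV_def)
  moreover have "filterlim complex_of_real (at 0) (at_right 0)"
    by (intro filterlim_atI tendsto_eq_intros | simp add: eventually_at_filter)+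
  ultimately show ?thesis
    unfolding of_real_mult mult.assoc[symmetric] by (rule filterlim_compose)
qed

text \<open>The binomial coefficient is of order \<open>\<epsilon>\<^sup>-\<^sup>j\<close> when \<open>a\<close> is of order \<open>\<epsilon>\<^sup>-\<^sup>1\<close>; distributing one factor \<open>\<epsilon>\<close> to
  each of its factors leaves two convergent expressions.\<close>
lemma gbinomial_scaled:
  assumes "\<epsilon> \<noteq> (0 :: complex)"
  shows "(a gchoose j) * w ^ j = (\<Prod>i = 0..<j. a * \<epsilon> - of_nat i * \<epsilon>) / fact j * (w / \<epsilon>) ^ j"
proof -
  have "(\<Prod>i = 0..<j. a * \<epsilon> - of_nat i * \<epsilon>) = (\<Prod>i = 0..<j. a - of_nat i) * \<epsilon> ^ j"
    by (simp add: prod.distrib flip: left_diff_distrib)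
  then show ?thesis
    using assms by (simp add: gbinomial_prod_rev power_divide)
qed

lemma scaled_fourier_tendsto:
  assumes "c > 0" "N > 0" "b > 0"
  shows "(scaled_fourier N c b \<mu> \<longlongrightarrow> exp (\<i> * complex_of_real (\<mu> * b)) *
            (\<Sum>j = 0..N - 1. (- \<i> * complex_of_real (\<mu> * b)) ^ j / fact j)) (at_right 0)"
proof -
  \<comment> \<open>The discrete level \<open>n\<close> enters only through \<open>n \<epsilon> \<longlonglongrightarrow> b\<close>, and \<open>x - 1\<close> only through the difference quotient.\<close>
  define s where "s \<epsilon> = real (nat \<lceil>b / \<epsilon>\<rceil>) * \<epsilon>" for \<epsilon>
  define q where "q \<epsilon> = (exp (\<i> * complex_of_real (\<mu> * \<epsilon>)) - 1) / complex_of_real \<epsilon>" for \<epsilon>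
  have s: "(s \<longlongrightarrow> b) (at_right 0)"
    unfolding s_def[abs_def] by (rule scaled_level_tendsto) fact
  have q: "(q \<longlongrightarrow> \<i> * complex_of_real \<mu>) (at_right 0)"
    unfolding q_def[abs_def] by (rule exp_difference_quotient_tendsto)
  have "((\<lambda>\<epsilon>. exp (\<i> * complex_of_real (\<mu> * s \<epsilon>)) *
      (\<Sum>j<N. (\<Prod>i = 0..<j. - complex_of_real (s \<epsilon>) - of_nat i * complex_of_real \<epsilon>) / fact j * q \<epsilon> ^ j))
      \<longlongrightarrow> exp (\<i> * complex_of_real (\<mu> * b)) *
      (\<Sum>j<N. (\<Prod>i = 0..<j. - complex_of_real b - of_nat i * complex_of_real 0) / fact j * (\<i> * complex_of_real \<mu>) ^ j))
      (at_right 0)"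
    by (intro tendsto_intros s q) auto
  also have "(\<Sum>j<N. (\<Prod>i = 0..<j. - complex_of_real b - of_nat i * complex_of_real 0) / fact j * (\<i> * complex_of_real \<mu>) ^ j)
      = (\<Sum>j = 0..N - 1. (- \<i> * complex_of_real (\<mu> * b)) ^ j / fact j)"
  proof -
    have "{..<N} = {0..N - 1}" using assms(2) by auto
    moreover have "(- \<i> * complex_of_real (\<mu> * b)) ^ j = (- complex_of_real b) ^ j * (\<i> * complex_of_real \<mu>) ^ j" for j
      by (simp add: mult_ac flip: power_mult_distrib)
    ultimately show ?thesis by simp
  qed
  finally show ?thesis
  proof (rule Lim_transform_eventually)
    have "exp (\<i> * complex_of_real (\<mu> * s \<epsilon>)) *
      (\<Sum>j<N. (\<Prod>i = 0..<j. - complex_of_real (s \<epsilon>) - of_nat i * complex_of_real \<epsilon>) / fact j * q \<epsilon> ^ j)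
      = scaled_fourier N c b \<mu> \<epsilon>" if "\<epsilon> > 0" for \<epsilon>
      using that gbinomial_scaled[of "complex_of_real \<epsilon>" "- of_nat (nat \<lceil>b / \<epsilon>\<rceil>)" _ "exp (\<i> * complex_of_real (\<mu> * \<epsilon>)) - 1"]
      by (simp add: scaled_fourier_eq[OF assms that] s_def q_def mult_ac flip: exp_of_nat_mult)
    then show "eventually (\<lambda>\<epsilon>. exp (\<i> * complex_of_real (\<mu> * s \<epsilon>)) *
      (\<Sum>j<N. (\<Prod>i = 0..<j. - complex_of_real (s \<epsilon>) - of_nat i * complex_of_real \<epsilon>) / fact j * q \<epsilon> ^ j)
      = scaled_fourier N c b \<mu> \<epsilon>) (at_right 0)"
      by (auto intro: eventually_mono[OF eventually_at_right_less])
  qed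
qed

theorem theorem7p3:
  fixes N :: nat and c b :: real
  assumes "N \<ge> 1" and "c > 0" and "b > 0"
  shows "(\<forall>\<beta> l :: int. \<beta> \<ge> 1 \<and> l \<in> {\<beta>..\<beta> + int N - 1} \<longrightarrow>
            is_continuation N c \<beta> l (passage_gf N c \<beta> l) \<and>
            (passage_gf N c \<beta> l \<longlongrightarrow> passage_place_prob N c \<beta> l) (at_left 1)) \<and>
         (\<forall>\<mu> :: real. (scaled_fourier N c b \<mu> \<longlongrightarrow> limit_fourier N c b \<mu>) (at_right 0)) \<and>
         (\<forall>\<mu> :: real. limit_fourier N c b \<mu> =
            exp (\<i> * complex_of_real (\<mu> * b)) *
            (\<Sum>j = 0..N - 1. (- \<i> * complex_of_real (\<mu> * b)) ^ j / fact j)) \<and>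
         limit_passage_prob N c b = 1"
proof -
  have N: "N > 0" using assms by simp
  have gf: "is_continuation N c \<beta> l (passage_gf N c \<beta> l) \<and>
            (passage_gf N c \<beta> l \<longlongrightarrow> passage_place_prob N c \<beta> l) (at_left 1)"
    if "\<beta> \<ge> 1 \<and> l \<in> {\<beta>..\<beta> + int N - 1}" for \<beta> l
    using passage_gf_limit(1,2)[OF assms(2) N, of \<beta> "nat (l - \<beta>)"] that by auto
  note lim = scaled_fourier_tendsto[OF assms(2) N assms(3)]
  have val: "limit_fourier N c b \<mu> = exp (\<i> * complex_of_real (\<mu> * b)) *
            (\<Sum>j = 0..N - 1. (- \<i> * complex_of_real (\<mu> * b)) ^ j / fact j)" for \<mu>
    unfolding limit_fourier_def by (rule tendsto_Lim[OF trivial_limit_at_right_real lim])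
  have "limit_passage_prob N c b = (\<Sum>j = 0..N - 1. 0 ^ j / fact j)"
    by (simp add: limit_passage_prob_def val)
  also have "\<dots> = 1"
    by (simp add: sum.atLeast_Suc_atMost power_0_left)
  finally show ?thesis
    using gf lim val by simp
qed

end
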